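(* Let $(X,d)$ be a uniformly uniquely geodesic space with a modulus of uniform uniqueness $\Phi:(0,\infty)^2\to(0,\infty)$. Additionally, suppose that $$d(z,(1-t)x+ty)\le(1-t)\,d(z,x)+t\,d(z,y)$$ for all $x,y,z\in X$ and all $t\in[0,1]$. Then $X$ satisfies the uniform betweenness property and the mapping $\Theta:(0,\infty)^3\to(0,\infty)$ defined by $$\Theta(\varepsilon,a,b)=\min\left\{a,\ \Phi\!\left(\min\left\{\frac{a\varepsilon}{8b},\frac a2\right\},b\right)\right\}$$ is a modulus of uniform betweenness for $X$.
   Context: A geodesic space is a metric space in which every two points $x,y$ are joined by a geodesic (an isometric embedding of $[0,d(x,y)]$ from $x$ to $y$). A geodesic space $(X,d)$ is uniformly uniquely geodesic if for all $\varepsilon,b>0$ there exists $\varphi>0$ such that for all $x,y,z,w\in X$ with $d(x,y)\le b$ and all $t\in[0,1]$: $\max\{d(z,x),d(w,x)\}\le t\,d(x,y)$ and $\max\{d(z,y),d(w,y)\}\le(1-t)\,d(x,y)+\varphi$ imply $d(z,w)\le\varepsilon$. A map $\Phi:(0,\infty)^2\to(0,\infty)$ such that $\varphi=\Phi(\varepsilon,b)$ works for all $\varepsilon,b>0$ is called a modulus of uniform uniqueness. Such a space is uniquely geodesic, and $(1-t)x+ty$ denotes the unique point $p$ with $d(p,x)=t\,d(x,y)$ and $d(p,y)=(1-t)\,d(x,y)$. Uniform betweenness property: a metric space $(X,d)$ satisfies it if for all $a,b,\varepsilon>0$ there is $\theta>0$ such that for all $x,y,z,w\in X$: if $\operatorname{sep}\{x,y,z,w\}\ge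 a$, $\operatorname{diam}\{x,y,z,w\}\le b$, $d(x,y)+d(y,z)\le d(x,z)+\theta$ and $d(y,z)+d(z,w)\le d(y,w)+\theta$, then $d(x,z)+d(z,w)\le d(x,w)+\varepsilon$. Here $\operatorname{diam}\{x,y,z,w\}$ is the largest of the pairwise distances, and $\operatorname{sep}\{x,y,z,w\}\ge a$ means that the four points are pairwise distinct and all six pairwise distances are $\ge a$. A function $\Theta:(0,\infty)^3\to(0,\infty)$ such that $\theta=\Theta(\varepsilon,a,b)$ works for all $\varepsilon,a,b>0$ is called a modulus of uniform betweenness. *)

theory Defs
  imports "HOL-Analysis.Abstract_Metric_Spaces"
begin

definition geodesic_from_to ::
    "'a set \<Rightarrow> ('a \<Rightarrow> 'a \<Rightarrow> real) \<Rightarrow> (real \<Rightarrow> 'a) \<Rightarrow> 'a \<Rightarrow> 'a \<Rightarrow> bool" where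
  "geodesic_from_to X d g x y \<longleftrightarrow>
     g \<in> {0..d x y} \<rightarrow> X \<and>
     (\<forall>s\<in>{0..d x y}. \<forall>t\<in>{0..d x y}. d (g s) (g t) = \<bar>s - t\<bar>) \<and>
     g 0 = x \<and> g (d x y) = y"

definition geodesic_space :: "'a set \<Rightarrow> ('a \<Rightarrow> 'a \<Rightarrow> real) \<Rightarrow> bool" where
  "geodesic_space X d \<longleftrightarrow>
     Metric_space X d \<and> (\<forall>x\<in>X. \<forall>y\<in>X. \<exists>g. geodesic_from_to X d g x y)"

(* The value phi works for the pair (eps, b). *)
definition uniqueness_bound ::
    "'a set \<Rightarrow> ('a \<Rightarrow> 'a \<Rightarrow> real) \<Rightarrow> real \<Rightarrow> real \<Rightarrow> real \<Rightarrow> bool" where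
  "uniqueness_bound X d \<epsilon> b \<phi> \<longleftrightarrow>
     (\<forall>x\<in>X. \<forall>y\<in>X. \<forall>z\<in>X. \<forall>w\<in>X. \<forall>t\<in>{0..1}.
        d x y \<le> b \<longrightarrow>
        max (d z x) (d w x) \<le> t * d x y \<longrightarrow>
        max (d z y) (d w y) \<le> (1 - t) * d x y + \<phi> \<longrightarrow>
        d z w \<le> \<epsilon>)"

definition uniformly_uniquely_geodesic :: "'a set \<Rightarrow> ('a \<Rightarrow> 'a \<Rightarrow> real) \<Rightarrow> bool" where
  "uniformly_uniquely_geodesic X d \<longleftrightarrow>
     geodesic_space X d \<and> (\<forall>\<epsilon>>0. \<forall>b>0. \<exists>\<phi>>0. uniqueness_bound X d \<epsilon> b \<phi>)"

(* Functions (0,oo)^n -> (0,oo) are represented by total real functions; only their values at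
   positive arguments matter, and these are required to be positive. *)
definition modulus_of_uniform_uniqueness ::
    "'a set \<Rightarrow> ('a \<Rightarrow> 'a \<Rightarrow> real) \<Rightarrow> (real \<Rightarrow> real \<Rightarrow> real) \<Rightarrow> bool" where
  "modulus_of_uniform_uniqueness X d \<Phi> \<longleftrightarrow>
     (\<forall>\<epsilon>>0. \<forall>b>0. \<Phi> \<epsilon> b > 0 \<and> uniqueness_bound X d \<epsilon> b (\<Phi> \<epsilon> b))"

(* geodesic_comb X d t x y is the point written (1 - t) x + t y. *)
definition geodesic_comb ::
    "'a set \<Rightarrow> ('a \<Rightarrow> 'a \<Rightarrow> real) \<Rightarrow> real \<Rightarrow> 'a \<Rightarrow> 'a \<Rightarrow> 'a" where
  "geodesic_comb X d t x y =
     (THE p. p \<in> X \<and> d p x = t * d x y \<and> d p y = (1 - t) * d x y)"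

(* The definite description above is well defined in the spaces where it is used. *)
lemma geodesic_comb_ex1:
  assumes "uniformly_uniquely_geodesic X d" "x \<in> X" "y \<in> X" "t \<in> {0..1}"
  shows "\<exists>!p. p \<in> X \<and> d p x = t * d x y \<and> d p y = (1 - t) * d x y"
proof -
  interpret Metric_space X d
    using assms(1) by (simp add: uniformly_uniquely_geodesic_def geodesic_space_def)
  obtain g where g: "geodesic_from_to X d g x y"
    using assms unfolding uniformly_uniquely_geodesic_def geodesic_space_def by blast
  define s where "s = t * d x y"
  have s: "0 \<le> s" "s \<le> d x y" using assms(4) by (auto simp: s_def mult_left_le_one_le)
  have g0: "g 0 = x" "g (d x y) = y" "g s \<in> X"
    and iso: "\<And>u v. \<lbrakk>0 \<le> u; u \<le> d x y; 0 \<le> v; v \<le> d x y\<rbrakk> \<Longrightarrow> d (g u) (g v) = \<bar>u - v\<bar>"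
    using g s by (auto simp: geodesic_from_to_def)
  have ex: "g s \<in> X \<and> d (g s) x = t * d x y \<and> d (g s) y = (1 - t) * d x y"
    using iso[of s 0] iso[of s "d x y"] g0 s by (simp add: s_def algebra_simps)
  have uniq: "p = q"
    if p: "p \<in> X \<and> d p x = t * d x y \<and> d p y = (1 - t) * d x y"
      and q: "q \<in> X \<and> d q x = t * d x y \<and> d q y = (1 - t) * d x y" for p q
  proof (rule ccontr)
    assume "p \<noteq> q"
    then have pos: "d p q > 0" using p q by simp
    moreover have "d x y + 1 > 0" by (simp add: add_nonneg_pos)
    ultimately obtain \<phi> where "\<phi> > 0" "uniqueness_bound X d (d p q / 2) (d x y + 1) \<phi>"
      using assms(1) unfolding uniformly_uniquely_geodesic_def by (meson half_gt_zero)
    then have "d p q \<le> d p q / 2" using p q assms unfolding uniqueness_bound_def by simp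
    then show False using pos by simp
  qed
  show ?thesis using ex uniq by blast
qed

definition diam4 :: "('a \<Rightarrow> 'a \<Rightarrow> real) \<Rightarrow> 'a \<Rightarrow> 'a \<Rightarrow> 'a \<Rightarrow> 'a \<Rightarrow> real" where
  "diam4 d x y z w = Max {d x y, d x z, d x w, d y z, d y w, d z w}"

(* sep {x, y, z, w} >= a *)
definition sep4_ge :: "('a \<Rightarrow> 'a \<Rightarrow> real) \<Rightarrow> 'a \<Rightarrow> 'a \<Rightarrow> 'a \<Rightarrow> 'a \<Rightarrow> real \<Rightarrow> bool" where
  "sep4_ge d x y z w a \<longleftrightarrow>
     distinct [x, y, z, w] \<and> (\<forall>r\<in>{d x y, d x z, d x w, d y z, d y w, d z w}. a \<le> r)"

(* The value theta works for the triple (eps, a, b). *)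
definition betweenness_bound ::
    "'a set \<Rightarrow> ('a \<Rightarrow> 'a \<Rightarrow> real) \<Rightarrow> real \<Rightarrow> real \<Rightarrow> real \<Rightarrow> real \<Rightarrow> bool" where
  "betweenness_bound X d \<epsilon> a b \<theta> \<longleftrightarrow>
     (\<forall>x\<in>X. \<forall>y\<in>X. \<forall>z\<in>X. \<forall>w\<in>X.
        sep4_ge d x y z w a \<longrightarrow>
        diam4 d x y z w \<le> b \<longrightarrow>
        d x y + d y z \<le> d x z + \<theta> \<longrightarrow>
        d y z + d z w \<le> d y w + \<theta> \<longrightarrow>
        d x z + d z w \<le> d x w + \<epsilon>)"

definition uniform_betweenness :: "'a set \<Rightarrow> ('a \<Rightarrow> 'a \<Rightarrow> real) \<Rightarrow> bool" where
  "uniform_betweenness X d \<longleftrightarrow>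
     Metric_space X d \<and> (\<forall>\<epsilon>>0. \<forall>a>0. \<forall>b>0. \<exists>\<theta>>0. betweenness_bound X d \<epsilon> a b \<theta>)"

definition modulus_of_uniform_betweenness ::
    "'a set \<Rightarrow> ('a \<Rightarrow> 'a \<Rightarrow> real) \<Rightarrow> (real \<Rightarrow> real \<Rightarrow> real \<Rightarrow> real) \<Rightarrow> bool" where
  "modulus_of_uniform_betweenness X d \<Theta> \<longleftrightarrow>
     (\<forall>\<epsilon>>0. \<forall>a>0. \<forall>b>0. \<Theta> \<epsilon> a b > 0 \<and> betweenness_bound X d \<epsilon> a b (\<Theta> \<epsilon> a b))"

end

(*
  If y lies almost between x and z, uniform uniqueness puts y within delta of the point u of the
  geodesic [x,z] with d(x,u) = d(x,y); likewise z is within delta of the point v of [w,y] with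
  d(w,v) = d(w,z). Convexity of d(x,-) along [w,y] bounds d(x,v), hence d(x,z), by a convex
  combination of d(x,w) and d(x,y). Since d(x,y) = d(x,z) - d(u,z) is at most
  d(x,z) - d(y,z) + delta, solving for d(x,z) gives the claim with an error linear in delta; the
  slack theta itself never enters the error.
*)
theory Submission
  imports Defs
begin

lemma geodesic_comb_dist:
  assumes "uniformly_uniquely_geodesic X d" "x \<in> X" "y \<in> X" "t \<in> {0..1}"
  shows "geodesic_comb X d t x y \<in> X"
    and "d (geodesic_comb X d t x y) x = t * d x y"
    and "d (geodesic_comb X d t x y) y = (1 - t) * d x y"
  using theI'[OF geodesic_comb_ex1[OF assms]] unfolding geodesic_comb_def by auto

text \<open>With \<open>t = d p m / d p q\<close>, both \<open>m\<close> and the comparison point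
  \<open>v\<close> lie at distance exactly \<open>t * d p q\<close> from \<open>p\<close>, so all
  the slack falls on the side of \<open>q\<close>, where the uniqueness bound tolerates it.\<close>

lemma near_geodesic_comb:
  assumes uug: "uniformly_uniquely_geodesic X d"
    and bound: "uniqueness_bound X d \<delta> b \<phi>" and "\<phi> \<ge> 0"
    and X: "p \<in> X" "q \<in> X" "m \<in> X"
    and "0 < d p q" "d p q \<le> b" "d p m \<le> d p q" "d p m + d m q \<le> d p q + \<phi>"
  obtains t v where "t \<in> {0..1}" "v = geodesic_comb X d t p q" "v \<in> X"
    "t * d p q = d p m" "d v p = d p m" "d v q = d p q - d p m" "d m v \<le> \<delta>"
proof -
  interpret Metric_space X d
    using uug by (simp add: uniformly_uniquely_geodesic_def geodesic_space_def)
  define t where "t = d p m / d p q"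
  define v where "v = geodesic_comb X d t p q"
  have t: "t \<in> {0..1}" "t * d p q = d p m"
    using assms by (auto simp: t_def)
  have v: "v \<in> X" "d v p = d p m" "d v q = d p q - d p m"
    using geodesic_comb_dist[OF uug X(1,2) t(1)] t(2) by (auto simp: v_def algebra_simps)
  have "max (d m p) (d v p) \<le> t * d p q"
    using t v by (simp add: commute)
  moreover have "max (d m q) (d v q) \<le> (1 - t) * d p q + \<phi>"
    using t v assms by (simp add: algebra_simps)
  ultimately have "d m v \<le> \<delta>"
    using bound X v(1) t(1) \<open>d p q \<le> b\<close> unfolding uniqueness_bound_def by blast
  then show thesis using that t v v_def by blast
qed

text \<open>Isolates the estimate for one triple and one value \<phi>; the theorem then only
  evaluates \<Phi> at \<delta>.\<close>

lemma betweenness_bound_of_uniqueness_bound: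
  fixes a b \<epsilon> :: real
  defines "\<delta> \<equiv> min (a * \<epsilon> / (8 * b)) (a / 2)"
  assumes uug: "uniformly_uniquely_geodesic X d"
    and convex: "\<And>x y z t. \<lbrakk>x \<in> X; y \<in> X; z \<in> X; t \<in> {0..1}\<rbrakk> \<Longrightarrow>
           d z (geodesic_comb X d t x y) \<le> (1 - t) * d z x + t * d z y"
    and pos: "\<epsilon> > 0" "a > 0" "b > 0" "\<phi> \<ge> 0"
    and bound: "uniqueness_bound X d \<delta> b \<phi>"
  shows "betweenness_bound X d \<epsilon> a b (min a \<phi>)"
  unfolding betweenness_bound_def
proof (intro ballI impI)
  fix x y z w
  assume X: "x \<in> X" "y \<in> X" "z \<in> X" "w \<in> X"
    and sep: "sep4_ge d x y z w a" and diam: "diam4 d x y z w \<le> b"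
    and xyz: "d x y + d y z \<le> d x z + min a \<phi>"
    and yzw: "d y z + d z w \<le> d y w + min a \<phi>"
  interpret Metric_space X d
    using uug by (simp add: uniformly_uniquely_geodesic_def geodesic_space_def)
  have lower: "a \<le> d x z" "a \<le> d y z" "a \<le> d w y" "a \<le> d z w"
    using sep by (auto simp: sep4_ge_def commute)
  have upper: "d x z \<le> b" "d w y \<le> b" "d z w \<le> b"
    using diam by (auto simp: diam4_def commute)
  have \<delta>: "\<delta> \<le> a / 2" "8 * b * \<delta> \<le> a * \<epsilon>"
    using pos by (auto simp: \<delta>_def min_def field_simps)
  \<comment> \<open>The minimum with \<open>a\<close> serves here: a slack of at most
    \<open>a\<close> is absorbed by \<open>a \<le> d y z\<close>, which leaves
    \<open>d x y \<le> d x z\<close>.\<close>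
  have "0 < d x z" "d x y \<le> d x z" "d x y + d y z \<le> d x z + \<phi>"
    using lower xyz pos by auto
  then obtain u where u: "u \<in> X" "d u z = d x z - d x y" "d y u \<le> \<delta>"
    using near_geodesic_comb[OF uug bound \<open>\<phi> \<ge> 0\<close> X(1,3,2) _ upper(1)] by metis
  \<comment> \<open>The second betweenness is read backwards, starting at \<open>w\<close>, so that
    \<open>v\<close> matches the distance from \<open>w\<close> to \<open>z\<close> exactly.\<close>
  have "0 < d w y" "d w z \<le> d w y" "d w z + d z y \<le> d w y + \<phi>"
    using lower yzw pos by (auto simp: commute)
  then obtain t v where t: "t \<in> {0..1}" "t * d w y = d w z"
    and v: "v = geodesic_comb X d t w y" "v \<in> X" "d v y = d w y - d w z" "d z v \<le> \<delta>"
    using near_geodesic_comb[OF uug bound \<open>\<phi> \<ge> 0\<close> X(4,2,3) _ upper(2)] by metis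
  define G where "G = d v y"
  have wy: "d w y = G + d z w"
    using v(3) by (simp add: G_def commute)
  \<comment> \<open>The bound \<delta> \<le> \<open>a / 2\<close> keeps \<open>G\<close> away from
    zero, which permits the final cancellation of \<open>G\<close>.\<close>
  have G: "a / 2 \<le> G" "G \<le> d y z + \<delta>"
    using triangle[OF X(2) v(2) X(3)] triangle[OF v(2) X(3,2)] v(4) \<delta> lower
    by (auto simp: G_def commute)
  have xy: "d x y \<le> d x z - d y z + \<delta>"
    using triangle[OF X(2) u(1) X(3)] u by linarith
  have xz: "d x z \<le> d x v + \<delta>"
    using triangle[OF X(1) v(2) X(3)] v(4) by (simp add: commute)
  \<comment> \<open>Multiplying the convexity inequality by \<open>d w y\<close> turns the weights
    \<open>1 - t\<close> and \<open>t\<close> into \<open>G\<close> and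
    \<open>d z w\<close>.\<close>
  have "(G + d z w) * (d x z - \<delta>) \<le> d w y * d x v"
    using xz wy by (auto intro!: mult_left_mono simp: G_def)
  also have "\<dots> \<le> d w y * ((1 - t) * d x w + t * d x y)"
    using convex[OF X(4,2,1) t(1)] v(1) by (simp add: mult_left_mono)
  also have "\<dots> = (d w y - t * d w y) * d x w + (t * d w y) * d x y"
    by (simp add: algebra_simps)
  also have "\<dots> = G * d x w + d z w * d x y"
    using wy t(2) by (simp add: commute)
  also have "\<dots> \<le> G * d x w + d z w * (d x z - d y z + \<delta>)"
    using xy by (simp add: mult_left_mono)
  finally have "G * (d x z - d x w) \<le> (G + 2 * d z w) * \<delta> - d z w * d y z"
    by (simp add: algebra_simps)
  \<comment> \<open>Trading \<open>d y z\<close> for \<open>G\<close> costs one more \<delta> and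
    lets \<open>G\<close> factor out of the left side.\<close>
  moreover have "d z w * G \<le> d z w * (d y z + \<delta>)"
    using G by (simp add: mult_left_mono)
  ultimately have main: "G * (d x z + d z w - d x w) \<le> G * \<delta> + 3 * (d z w * \<delta>)"
    by (simp add: algebra_simps)
  have "\<delta> \<ge> 0" using pos by (simp add: \<delta>_def)
  \<comment> \<open>Error budget: \<open>G * \<delta>\<close> is at most
    \<open>G * \<epsilon> / 8\<close>, and \<open>3 * (d z w * \<delta>)\<close> is at most
    \<open>3 * a * \<epsilon> / 8\<close>, hence at most \<open>3 * G * \<epsilon> / 4\<close>. The
    total stays below \<open>G * \<epsilon>\<close>.\<close>
  have "d z w * \<delta> \<le> b * \<delta>" "a * \<delta> \<le> b * \<delta>"
    using upper lower \<open>\<delta> \<ge> 0\<close> by (auto intro: mult_right_mono)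
  moreover have "a * \<epsilon> \<le> 2 * (G * \<epsilon>)"
    using mult_right_mono[OF G(1), of \<epsilon>] pos by simp
  moreover have "8 * \<delta> \<le> \<epsilon>"
  proof -
    have "a * (8 * \<delta>) \<le> a * \<epsilon>" using \<delta>(2) \<open>a * \<delta> \<le> b * \<delta>\<close> by linarith
    then show ?thesis using pos by simp
  qed
  then have "8 * (G * \<delta>) \<le> G * \<epsilon>"
    using mult_left_mono[of "8 * \<delta>" \<epsilon> G] by (simp add: G_def)
  ultimately have "G * (d x z + d z w - d x w) \<le> G * \<epsilon>"
    using main \<delta>(2) mult_pos_pos[OF pos(2,1)] by linarith
  then show "d x z + d z w \<le> d x w + \<epsilon>"
    using G(1) pos by simp
qed

theorem theorem3p9:
  fixes X :: "'a set" and d :: "'a \<Rightarrow> 'a \<Rightarrow> real" and \<Phi> :: "real \<Rightarrow> real \<Rightarrow> real"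
  assumes "uniformly_uniquely_geodesic X d"
    and "modulus_of_uniform_uniqueness X d \<Phi>"
    and "\<And>x y z t. \<lbrakk>x \<in> X; y \<in> X; z \<in> X; t \<in> {0..1}\<rbrakk> \<Longrightarrow>
           d z (geodesic_comb X d t x y) \<le> (1 - t) * d z x + t * d z y"
  shows "uniform_betweenness X d \<and>
         modulus_of_uniform_betweenness X d
           (\<lambda>\<epsilon> a b. min a (\<Phi> (min (a * \<epsilon> / (8 * b)) (a / 2)) b))"
proof -
  let ?\<Theta> = "\<lambda>\<epsilon> a b. min a (\<Phi> (min (a * \<epsilon> / (8 * b)) (a / 2)) b)"
  have modulus: "?\<Theta> \<epsilon> a b > 0 \<and> betweenness_bound X d \<epsilon> a b (?\<Theta> \<epsilon> a b)"
    if pos: "\<epsilon> > 0" "a > 0" "b > 0" for \<epsilon> a b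
  proof -
    let ?\<delta> = "min (a * \<epsilon> / (8 * b)) (a / 2)"
    have "?\<delta> > 0" using pos by simp
    then have \<Phi>: "\<Phi> ?\<delta> b > 0" "uniqueness_bound X d ?\<delta> b (\<Phi> ?\<delta> b)"
      using assms(2) pos unfolding modulus_of_uniform_uniqueness_def by blast+
    then show ?thesis
      using betweenness_bound_of_uniqueness_bound[OF assms(1,3) pos _ \<Phi>(2)] pos by simp
  qed
  moreover have "Metric_space X d"
    using assms(1) by (simp add: uniformly_uniquely_geodesic_def geodesic_space_def)
  ultimately show ?thesis
    unfolding uniform_betweenness_def modulus_of_uniform_betweenness_def by blast
qed

end
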